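(* Let $\alpha:I\subset\mathbb{R}\to E^3$ be a unit speed curve with curvature $\kappa$ and torsion $\tau$. Then $\alpha$ is a rectifying slant helix if and only if its curvature and torsion satisfy $$\kappa(s)=\frac{c_3}{\left(1+(c_1s+c_2)^2\right)^{3/2}},\qquad \tau(s)=\frac{c_3\,(c_1s+c_2)}{\left(1+(c_1s+c_2)^2\right)^{3/2}},$$ where $c_1,c_2,c_3$ are constants with $c_1\neq 0$, $c_2\in\mathbb{R}$ and $c_3\in\mathbb{R}^+$.
   Context: $E^3$ is $\mathbb{R}^3$ with the Euclidean metric $g=dx_1^2+dx_2^2+dx_3^2$. A curve is unit speed if it is parametrized by arclength $s$, i.e. $g(\alpha'(s),\alpha'(s))=1$. Curves are assumed to have at least four continuous derivatives and to satisfy $t'(s)\neq 0$ for all $s$, where $t=\alpha'$ is the unit tangent, so that the Frenet frame $\{t,n,b\}$ (tangent, principal normal, binormal) is defined, with $t'=\kappa n$, $n'=-\kappa t+\tau b$, $b'=-\tau n$, where $\kappa$ is the curvature and $\tau$ the torsion. A curve is called a slant helix if its principal normal vector field $n$ makes a constant angle with a fixed line in space. A unit speed curve is called a rectifying curve if its position vector always lies in its rectifying plane, i.e. $\alpha(s)=\lambda(s)t(s)+\mu(s)b(s)$ for some functions $\lambda,\mu$. A rectifying slant helix is a unit speed slant helix whose position vector always lies in its rectifying plane.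
   Formalization: "α is a rectifying slant helix" is proved in the form "some translate α − p is a rectifying slant helix", since curvature and torsion are translation invariant while being rectifying depends on the origin, so the literal "if" direction is false. *)

theory Defs
  imports "HOL-Analysis.Analysis"
begin

text \<open>
  Curves are maps on a nondegenerate interval \<open>I\<close> of any kind. Derivatives are taken
  within \<open>I\<close>, so they are one-sided at an endpoint belonging to \<open>I\<close>.
\<close>

definition curve_deriv :: "real set \<Rightarrow> (real \<Rightarrow> real^3) \<Rightarrow> real \<Rightarrow> real^3" where
  "curve_deriv I \<alpha> s = vector_derivative \<alpha> (at s within I)"

definition C_k_curve :: "nat \<Rightarrow> real set \<Rightarrow> (real \<Rightarrow> real^3) \<Rightarrow> bool" where
  "C_k_curve k I \<alpha> \<longleftrightarrow>
     (\<forall>j<k. (curve_deriv I ^^ j) \<alpha> differentiable_on I) \<and>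
     continuous_on I ((curve_deriv I ^^ k) \<alpha>)"

definition unit_speed :: "real set \<Rightarrow> (real \<Rightarrow> real^3) \<Rightarrow> bool" where
  "unit_speed I \<alpha> \<longleftrightarrow> (\<forall>s\<in>I. curve_deriv I \<alpha> s \<bullet> curve_deriv I \<alpha> s = 1)"

definition tangent :: "real set \<Rightarrow> (real \<Rightarrow> real^3) \<Rightarrow> real \<Rightarrow> real^3" where
  "tangent I \<alpha> = curve_deriv I \<alpha>"

definition curvature :: "real set \<Rightarrow> (real \<Rightarrow> real^3) \<Rightarrow> real \<Rightarrow> real" where
  "curvature I \<alpha> s = norm (curve_deriv I (tangent I \<alpha>) s)"

definition normal_vec :: "real set \<Rightarrow> (real \<Rightarrow> real^3) \<Rightarrow> real \<Rightarrow> real^3" where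
  "normal_vec I \<alpha> s = curve_deriv I (tangent I \<alpha>) s /\<^sub>R curvature I \<alpha> s"

definition binormal :: "real set \<Rightarrow> (real \<Rightarrow> real^3) \<Rightarrow> real \<Rightarrow> real^3" where
  "binormal I \<alpha> s = cross3 (tangent I \<alpha> s) (normal_vec I \<alpha> s)"

text \<open>The sign convention is that of the Frenet equation \<open>b' = - \<tau> n\<close>.\<close>

definition torsion :: "real set \<Rightarrow> (real \<Rightarrow> real^3) \<Rightarrow> real \<Rightarrow> real" where
  "torsion I \<alpha> s = - (curve_deriv I (binormal I \<alpha>) s \<bullet> normal_vec I \<alpha> s)"

definition frenet_curve :: "real set \<Rightarrow> (real \<Rightarrow> real^3) \<Rightarrow> bool" where
  "frenet_curve I \<alpha> \<longleftrightarrow>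
     is_interval I \<and> interior I \<noteq> {} \<and> C_k_curve 4 I \<alpha> \<and>
     (\<forall>s\<in>I. curve_deriv I (tangent I \<alpha>) s \<noteq> 0)"

definition vec_angle :: "real^3 \<Rightarrow> real^3 \<Rightarrow> real" where
  "vec_angle x y = arccos ((x \<bullet> y) / (norm x * norm y))"

text \<open>
  The fixed line is given by a direction vector \<open>u\<close>. Orienting the line does not matter:
  the principal normal is continuous on the interval \<open>I\<close>, so its angle with the
  unoriented line is constant iff its angle with \<open>u\<close> is.
\<close>

definition slant_helix :: "real set \<Rightarrow> (real \<Rightarrow> real^3) \<Rightarrow> bool" where
  "slant_helix I \<alpha> \<longleftrightarrow>
     (\<exists>u \<theta>. u \<noteq> 0 \<and> (\<forall>s\<in>I. vec_angle (normal_vec I \<alpha> s) u = \<theta>))"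

text \<open>The position vector is taken with respect to the origin \<open>0\<close>.\<close>

definition rectifying_curve :: "real set \<Rightarrow> (real \<Rightarrow> real^3) \<Rightarrow> bool" where
  "rectifying_curve I \<alpha> \<longleftrightarrow>
     unit_speed I \<alpha> \<and>
     (\<exists>l m :: real \<Rightarrow> real. \<forall>s\<in>I. \<alpha> s = l s *\<^sub>R tangent I \<alpha> s + m s *\<^sub>R binormal I \<alpha> s)"

text \<open>
  Curvature and torsion determine a curve only up to rigid motion, whereas being rectifying
  depends on the origin (a nontrivial translate of a rectifying slant helix is never
  rectifying). A characterization by curvature and torsion therefore has to allow a
  translation \<open>\<lambda>s. \<alpha> s - p\<close>, that is, a choice \<open>p\<close> of the origin.
\<close>

definition rectifying_slant_helix :: "real set \<Rightarrow> (real \<Rightarrow> real^3) \<Rightarrow> bool" where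
  "rectifying_slant_helix I \<alpha> \<longleftrightarrow> slant_helix I \<alpha> \<and> rectifying_curve I \<alpha>"

end

theory Submission imports Defs begin

text \<open>
  Both properties of the curve say that a vector with simple coordinates in the moving frame
  \<open>(t, n, b)\<close> does not move, and the Frenet equations turn this into equations for the
  curvature \<open>\<kappa>\<close> and the torsion \<open>\<tau>\<close>.

  \<^emph>\<open>Rectifying.\<close> If \<open>\<alpha> - p = \<lambda> t + \<mu> b\<close>, then differentiating the three coordinates of \<open>\<alpha> - p\<close>
  gives \<open>\<lambda>' = 1\<close>, \<open>\<mu>' = 0\<close> and \<open>\<lambda> \<kappa> = \<mu> \<tau>\<close>. Hence \<open>\<lambda> = s + d\<close>, and \<open>\<mu>\<close> is a constant; it is not
  zero, since otherwise \<open>\<lambda>\<close> would vanish identically. So \<open>\<tau> / \<kappa>\<close> is a nonconstant affine function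
  \<open>f s = c1 s + c2\<close> (\<open>rectifying_imp_affine_ratio\<close>). Conversely, if \<open>\<tau> = f \<kappa>\<close>, then
  \<open>\<alpha> - (f t + b) / c1\<close> has derivative zero, and its constant value is the origin with respect to
  which the curve is rectifying (\<open>affine_ratio_imp_rectifying\<close>).

  \<^emph>\<open>Slant.\<close> Suppose \<open>\<tau> = f \<kappa>\<close> and \<open>n \<bullet> u = c\<close> is constant. Differentiating once shows
  \<open>t \<bullet> u = f (b \<bullet> u)\<close>, and differentiating this relation gives \<open>c1 (b \<bullet> u) = \<kappa> c (1 + f\<^sup>2)\<close>.
  Expanding \<open>u\<close> in the frame gives \<open>u \<bullet> u = c\<^sup>2 + (b \<bullet> u)\<^sup>2 (1 + f\<^sup>2)\<close>; here \<open>c \<noteq> 0\<close>, since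
  otherwise \<open>b \<bullet> u = 0\<close> and \<open>u = 0\<close>. Eliminating \<open>b \<bullet> u\<close> shows that \<open>\<kappa>\<^sup>2 (1 + f\<^sup>2)\<^sup>3\<close> is
  constant (\<open>slant_imp_curvature\<close>). Conversely these relations prescribe the axis: if \<open>\<kappa>\<close> is
  \<open>c3\<close> divided by the power of \<open>1 + f\<^sup>2\<close> with exponent \<open>3/2\<close>, then
  \<open>c1 n + (c3 / sqrt (1 + f\<^sup>2)) (f t + b)\<close> is a constant vector (\<open>curvature_imp_slant\<close>).
\<close>

section \<open>Derivatives on intervals and orthonormal expansions\<close>

text \<open>
  Derivatives within \<open>I\<close> are unique because no point of an interval with interior points is isolated
  in it. Applied to a product of two frame vectors, this is how the Frenet equations and
  the coordinate equations below are read off.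
\<close>

lemma vector_derivative_of_constant_on:
  fixes f :: "real \<Rightarrow> 'a::real_normed_vector"
  assumes I: "is_interval I" "interior I \<noteq> {}" and s: "s \<in> I"
    and const: "\<And>x. x \<in> I \<Longrightarrow> f x = c"
    and D: "(f has_vector_derivative D) (at s within I)"
  shows "D = 0"
proof (rule vector_derivative_unique_within[OF _ D])
  have "\<not> (\<exists>a. I = {a})" using I(2) by (metis interior_singleton)
  moreover have "connected I" using I(1) by (simp add: is_interval_connected_1)
  ultimately have "s islimpt I" using s connected_imp_perfect by blast
  then show "at s within I \<noteq> bot" by (simp add: trivial_limit_within)
  show "(f has_vector_derivative 0) (at s within I)"
    by (rule has_vector_derivative_transform[OF s, of f "\<lambda>_. c"]) (auto simp: const)
qed

lemma constant_on_of_zero_derivative: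
  fixes f :: "real \<Rightarrow> 'a::real_normed_vector"
  assumes "is_interval I"
    and "\<And>s. s \<in> I \<Longrightarrow> (f has_vector_derivative 0) (at s within I)"
  obtains c where "\<And>s. s \<in> I \<Longrightarrow> f s = c"
  using has_vector_derivative_zero_constant[of I f] assms
  by (metis is_interval_convex_1)

lemmas has_vector_derivative_inner = bounded_bilinear.has_vector_derivative[OF bounded_bilinear_inner]

lemma powr_three_halves: "0 < w \<Longrightarrow> w powr (3/2) = w * sqrt (w::real)"
  using powr_add[of w 1 "1/2"] by (simp add: powr_half_sqrt)

lemma inner_cross3_self: "cross3 x y \<bullet> cross3 x y = (x \<bullet> x) * (y \<bullet> y) - (x \<bullet> y)\<^sup>2"
  using norm_cross_dot[of x y] by (simp add: power_mult_distrib power2_norm_eq_inner)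

lemma orthonormal_expansion_cross3:
  fixes t n x :: "real^3"
  assumes "t \<bullet> t = 1" "n \<bullet> n = 1" "t \<bullet> n = 0"
  shows "x = (x \<bullet> t) *\<^sub>R t + (x \<bullet> n) *\<^sub>R n + (x \<bullet> cross3 t n) *\<^sub>R cross3 t n"
proof -
  let ?b = "cross3 t n"
  define y where "y = x - ((x \<bullet> t) *\<^sub>R t + (x \<bullet> n) *\<^sub>R n + (x \<bullet> ?b) *\<^sub>R ?b)"
  have b: "?b \<bullet> ?b = 1" "t \<bullet> ?b = 0" "n \<bullet> ?b = 0"
    using assms by (simp_all add: inner_cross3_self dot_cross_self)
  have y: "y \<bullet> t = 0" "y \<bullet> n = 0" "y \<bullet> ?b = 0"
    using assms b by (simp_all add: y_def inner_simps inner_commute)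
  \<comment> \<open>The remainder \<open>y\<close> is orthogonal to \<open>t \<times> n\<close>, and by the triple product expansion also
    parallel to it.\<close>
  have "cross3 y ?b = 0"
    using y by (simp add: Lagrange inner_commute)
  then have "y \<bullet> y = 0"
    using inner_cross3_self[of y ?b] y b by simp
  then show ?thesis by (simp add: y_def)
qed

section \<open>Curves with an abstract Frenet frame\<close>

text \<open>
  All that the argument needs of a curve is a solution of the Frenet system. Stating this
  as a locale separates the geometry from the quotients and norms by which the frame is defined.
\<close>

locale frenet_frame =
  fixes I :: "real set" and \<alpha> T N B :: "real \<Rightarrow> real^3" and \<kappa> \<tau> :: "real \<Rightarrow> real"
  assumes interval: "is_interval I" "interior I \<noteq> {}"
    and orthonormal: "\<And>s. s \<in> I \<Longrightarrow> T s \<bullet> T s = 1" "\<And>s. s \<in> I \<Longrightarrow> N s \<bullet> N s = 1"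
      "\<And>s. s \<in> I \<Longrightarrow> T s \<bullet> N s = 0"
    and B_cross: "\<And>s. B s = cross3 (T s) (N s)"
    and pos: "\<And>s. s \<in> I \<Longrightarrow> 0 < \<kappa> s"
    and \<alpha>': "\<And>s. s \<in> I \<Longrightarrow> (\<alpha> has_vector_derivative T s) (at s within I)"
    and T': "\<And>s. s \<in> I \<Longrightarrow> (T has_vector_derivative \<kappa> s *\<^sub>R N s) (at s within I)"
    and N': "\<And>s. s \<in> I \<Longrightarrow>
      (N has_vector_derivative - \<kappa> s *\<^sub>R T s + \<tau> s *\<^sub>R B s) (at s within I)"
    and B': "\<And>s. s \<in> I \<Longrightarrow> (B has_vector_derivative - \<tau> s *\<^sub>R N s) (at s within I)"
begin

lemma orthonormal_binormal:
  assumes "s \<in> I"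
  shows "B s \<bullet> B s = 1" "T s \<bullet> B s = 0" "N s \<bullet> B s = 0"
  using orthonormal[OF assms] by (simp_all add: B_cross inner_cross3_self dot_cross_self)

lemmas frame_products = orthonormal orthonormal_binormal

lemma frame_expansion:
  "s \<in> I \<Longrightarrow> x = (x \<bullet> T s) *\<^sub>R T s + (x \<bullet> N s) *\<^sub>R N s + (x \<bullet> B s) *\<^sub>R B s"
  unfolding B_cross by (rule orthonormal_expansion_cross3) (auto simp: orthonormal)

lemma interval_point: obtains s where "s \<in> I"
  using interval(2) interior_subset by blast

text \<open>
  The three coordinates of \<open>\<alpha> - p\<close> satisfy \<open>l' = 1\<close>, \<open>m' = 0\<close> and, from the vanishing normal one,
  \<open>\<kappa> l = \<tau> m\<close>.
\<close>

lemma rectifying_imp_affine_ratio: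
  assumes rect: "\<And>s. s \<in> I \<Longrightarrow> (\<alpha> s - p) \<bullet> N s = 0"
  obtains c1 c2 :: real where "c1 \<noteq> 0" "\<And>s. s \<in> I \<Longrightarrow> \<tau> s = (c1 * s + c2) * \<kappa> s"
proof -
  define l where "l s = (\<alpha> s - p) \<bullet> T s" for s
  define m where "m s = (\<alpha> s - p) \<bullet> B s" for s
  have pos': "((\<lambda>s. \<alpha> s - p) has_vector_derivative T s) (at s within I)" if "s \<in> I" for s
    using \<alpha>'[OF that] by (auto intro!: derivative_eq_intros)
  have "(l has_vector_derivative 1) (at s within I)" if "s \<in> I" for s
    unfolding l_def[abs_def]
    by (rule has_vector_derivative_eq_rhs[OF has_vector_derivative_inner[OF pos'[OF that] T'[OF that]]])
      (use that in \<open>simp add: frame_products rect\<close>)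
  then have "((\<lambda>s. l s - s) has_vector_derivative 0) (at s within I)" if "s \<in> I" for s
    using that by (auto intro!: derivative_eq_intros)
  then obtain d where d: "\<And>s. s \<in> I \<Longrightarrow> l s - s = d"
    by (rule constant_on_of_zero_derivative[OF interval(1)]) auto
  have "(m has_vector_derivative 0) (at s within I)" if "s \<in> I" for s
    unfolding m_def[abs_def]
    by (rule has_vector_derivative_eq_rhs[OF has_vector_derivative_inner[OF pos'[OF that] B'[OF that]]])
      (use that in \<open>simp add: frame_products rect\<close>)
  then obtain k where k: "\<And>s. s \<in> I \<Longrightarrow> m s = k"
    by (rule constant_on_of_zero_derivative[OF interval(1)]) auto
  have balance: "\<tau> s * m s = \<kappa> s * l s" if "s \<in> I" for s
  proof -
    have "(\<alpha> s - p) \<bullet> (- \<kappa> s *\<^sub>R T s + \<tau> s *\<^sub>R B s) + T s \<bullet> N s = 0"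
      by (rule vector_derivative_of_constant_on[OF interval that rect
            has_vector_derivative_inner[OF pos'[OF that] N'[OF that]]])
    then show ?thesis
      using that by (simp add: frame_products inner_simps l_def m_def)
  qed
  have "k \<noteq> 0"
  proof
    assume "k = 0"
    then have "l s = 0" if "s \<in> I" for s
      using balance[OF that] pos[OF that] k[OF that] by simp
    \<comment> \<open>Then \<open>s \<mapsto> - s\<close> would be constant on an interval with interior points.\<close>
    then have "(\<lambda>s. - s) s = d" if "s \<in> I" for s using d[OF that] that by simp
    from interval_point obtain s where "s \<in> I" .
    have "- (1::real) = 0"
      by (rule vector_derivative_of_constant_on[OF interval \<open>s \<in> I\<close>, of "\<lambda>s. - s" d])
        (use \<open>\<And>s. s \<in> I \<Longrightarrow> (\<lambda>s. - s) s = d\<close> in \<open>auto intro!: derivative_eq_intros\<close>)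
    then show False by simp
  qed
  show thesis
  proof (rule that)
    show "1 / k \<noteq> 0" using \<open>k \<noteq> 0\<close> by simp
    show "\<tau> s = (1 / k * s + d / k) * \<kappa> s" if "s \<in> I" for s
      using balance[OF that] d[OF that] k[OF that] \<open>k \<noteq> 0\<close>
      by (simp add: field_simps)
  qed
qed

text \<open>
  The rectifying position vector is forced: its binormal coordinate must be \<open>1 / c1\<close> and its tangential
  one \<open>\<tau> / \<kappa>\<close> times that. The normal terms in its derivative cancel, which
  leaves \<open>T = \<alpha>'\<close>.
\<close>

lemma affine_ratio_imp_rectifying:
  assumes c1: "c1 \<noteq> 0" and ratio: "\<And>s. s \<in> I \<Longrightarrow> \<tau> s = (c1 * s + c2) * \<kappa> s"
  obtains p where "\<And>s. s \<in> I \<Longrightarrow> \<alpha> s - p = ((c1 * s + c2) / c1) *\<^sub>R T s + (1 / c1) *\<^sub>R B s"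
proof -
  let ?q = "\<lambda>s. \<alpha> s - (((c1 * s + c2) / c1) *\<^sub>R T s + (1 / c1) *\<^sub>R B s)"
  have "(?q has_vector_derivative 0) (at s within I)" if s: "s \<in> I" for s
  proof -
    have "((\<lambda>s. (c1 * s + c2) / c1) has_real_derivative 1) (at s within I)"
      using c1 by (auto intro!: derivative_eq_intros)
    then have "((\<lambda>s. ((c1 * s + c2) / c1) *\<^sub>R T s) has_vector_derivative
        ((c1 * s + c2) / c1) *\<^sub>R \<kappa> s *\<^sub>R N s + 1 *\<^sub>R T s) (at s within I)"
      by (rule has_vector_derivative_scaleR[OF _ T'[OF s]])
    moreover have "((\<lambda>s. (1 / c1) *\<^sub>R B s) has_vector_derivative (1 / c1) *\<^sub>R - \<tau> s *\<^sub>R N s)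
        (at s within I)"
      using bounded_linear.has_vector_derivative[OF bounded_linear_scaleR_right B'[OF s]] .
    ultimately have "(?q has_vector_derivative
        T s - ((((c1 * s + c2) / c1) *\<^sub>R \<kappa> s *\<^sub>R N s + 1 *\<^sub>R T s) + (1 / c1) *\<^sub>R - \<tau> s *\<^sub>R N s))
        (at s within I)"
      by (intro has_vector_derivative_diff has_vector_derivative_add \<alpha>'[OF s])
    then show ?thesis by (simp add: ratio[OF s])
  qed
  then obtain p where "\<And>s. s \<in> I \<Longrightarrow> ?q s = p"
    by (rule constant_on_of_zero_derivative[OF interval(1)]) auto
  then show thesis by (intro that[of p]) (auto simp: algebra_simps)
qed

text \<open>
  Only the binormal coordinate \<open>e\<close> of the axis is unknown, as its tangential coordinate \<open>a\<close> is
  \<open>(c1 s + c2) e\<close>. The derivative of this relation and the constancy of \<open>u \<bullet> u\<close> are two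
  equations between \<open>e\<close> and \<open>\<kappa>\<close>, from which \<open>e\<close> can be eliminated. They determine \<open>\<kappa>\<^sup>2\<close>, and
  \<open>\<kappa> > 0\<close> takes care of the sign.
\<close>

lemma slant_imp_curvature:
  assumes c1: "c1 \<noteq> 0" and ratio: "\<And>s. s \<in> I \<Longrightarrow> \<tau> s = (c1 * s + c2) * \<kappa> s"
    and u: "u \<noteq> 0" and slant: "\<And>s. s \<in> I \<Longrightarrow> N s \<bullet> u = c"
  obtains c3 where "c3 > 0" "\<And>s. s \<in> I \<Longrightarrow> \<kappa> s = c3 / (1 + (c1 * s + c2)\<^sup>2) powr (3/2)"
proof -
  define f where "f s = c1 * s + c2" for s
  define w where "w s = 1 + (f s)\<^sup>2" for s
  define a where "a s = T s \<bullet> u" for s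
  define e where "e s = B s \<bullet> u" for s
  have w: "w s > 0" for s by (simp add: w_def add_pos_nonneg)
  have inner_u: "((\<lambda>s. X s \<bullet> u) has_vector_derivative D \<bullet> u) (at s within I)"
    if "(X has_vector_derivative D) (at s within I)" for X D s
    using bounded_linear.has_vector_derivative[OF bounded_linear_inner_left that] .
  have ae: "a s = f s * e s" if "s \<in> I" for s
  proof -
    have "(- \<kappa> s *\<^sub>R T s + \<tau> s *\<^sub>R B s) \<bullet> u = 0"
      by (rule vector_derivative_of_constant_on[OF interval that slant inner_u[OF N'[OF that]]])
    then have "\<kappa> s * a s = \<kappa> s * (f s * e s)"
      using ratio[OF that] by (simp add: a_def e_def f_def inner_add_left algebra_simps)
    then show ?thesis using pos[OF that] by simp
  qed
  have ce: "c1 * e s = \<kappa> s * c * w s" if s: "s \<in> I" for s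
  proof -
    have "(a has_vector_derivative \<kappa> s * c) (at s within I)"
      using inner_u[OF T'[OF s]] by (simp add: a_def[abs_def] slant[OF s])
    moreover have e': "(e has_vector_derivative - \<tau> s * c) (at s within I)"
      using inner_u[OF B'[OF s]] by (simp add: e_def[abs_def] slant[OF s])
    have "(f has_vector_derivative c1) (at s within I)"
      unfolding f_def by (auto intro!: derivative_eq_intros)
    then have "((\<lambda>s. f s * e s) has_vector_derivative f s * (- \<tau> s * c) + c1 * e s) (at s within I)"
      by (rule has_vector_derivative_mult[OF _ e'])
    ultimately have "((\<lambda>s. a s - f s * e s) has_vector_derivative
        \<kappa> s * c - (f s * (- \<tau> s * c) + c1 * e s)) (at s within I)"
      by (rule has_vector_derivative_diff)
    from vector_derivative_of_constant_on[OF interval s _ this, of 0] ae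
    have "\<kappa> s * c - (f s * (- \<tau> s * c) + c1 * e s) = 0" by simp
    then show ?thesis
      using ratio[OF s] by (simp add: w_def f_def power2_eq_square algebra_simps)
  qed
  have ew: "(e s)\<^sup>2 * w s = u \<bullet> u - c\<^sup>2" if s: "s \<in> I" for s
  proof -
    have "u \<bullet> u = u \<bullet> ((u \<bullet> T s) *\<^sub>R T s + (u \<bullet> N s) *\<^sub>R N s + (u \<bullet> B s) *\<^sub>R B s)"
      using frame_expansion[OF s, of u] by simp
    also have "\<dots> = (a s)\<^sup>2 + c\<^sup>2 + (e s)\<^sup>2"
      using slant[OF s]
      by (simp add: inner_add_right a_def e_def inner_commute power2_eq_square)
    finally show ?thesis
      using ae[OF s] by (simp add: w_def power_mult_distrib algebra_simps)
  qed
  from interval_point obtain s0 where s0: "s0 \<in> I" .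
  have "c \<noteq> 0"
  proof
    assume "c = 0"
    then have "e s0 = 0" using ce[OF s0] c1 by simp
    then show False using ew[OF s0] u \<open>c = 0\<close> by simp
  qed
  have "e s0 \<noteq> 0"
    using ce[OF s0] pos[OF s0] w[of s0] \<open>c \<noteq> 0\<close> by auto
  then have gap: "u \<bullet> u - c\<^sup>2 > 0"
    using ew[OF s0] w[of s0] by (metis mult_pos_pos zero_less_power2)
  define c3 where "c3 = \<bar>c1 / c\<bar> * sqrt (u \<bullet> u - c\<^sup>2)"
  have c3: "c3 > 0" using gap c1 \<open>c \<noteq> 0\<close> by (simp add: c3_def)
  have "\<kappa> s = c3 / (w s) powr (3/2)" if s: "s \<in> I" for s
  proof -
    let ?P = "w s * sqrt (w s)"
    have "(\<kappa> s * ?P)\<^sup>2 * c\<^sup>2 = (\<kappa> s * c * w s)\<^sup>2 * w s"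
      using w[of s] by (simp add: power_mult_distrib)
    also have "\<dots> = c1\<^sup>2 * ((e s)\<^sup>2 * w s)"
      by (simp add: ce[OF s, symmetric] power_mult_distrib)
    also have "\<dots> = c3\<^sup>2 * c\<^sup>2"
      using gap \<open>c \<noteq> 0\<close>
      by (simp add: ew[OF s] c3_def power_mult_distrib power_divide)
    finally have "(\<kappa> s * ?P)\<^sup>2 = c3\<^sup>2" using \<open>c \<noteq> 0\<close> by simp
    then have "\<kappa> s * ?P = c3"
      using pos[OF s] w[of s] c3 by (subst (asm) power2_eq_iff_nonneg) auto
    then show ?thesis
      using w[of s] powr_three_halves[OF w, of s] by (auto simp: field_simps)
  qed
  with c3 show thesis by (intro that[of c3]) (auto simp: w_def f_def)
qed

text \<open>
  The axis comes from solving the equations of the previous lemma for the coordinates of \<open>u\<close>. They are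
  homogeneous in \<open>u\<close>, so \<open>N \<bullet> u = c1\<close> may be chosen; then \<open>B \<bullet> u = \<kappa> (1 + (c1 s + c2)\<^sup>2)\<close>.
\<close>

lemma curvature_imp_slant:
  assumes c1: "c1 \<noteq> 0" and ratio: "\<And>s. s \<in> I \<Longrightarrow> \<tau> s = (c1 * s + c2) * \<kappa> s"
    and curv: "\<And>s. s \<in> I \<Longrightarrow> \<kappa> s = c3 / (1 + (c1 * s + c2)\<^sup>2) powr (3/2)"
  obtains u where "u \<noteq> 0" "\<And>s. s \<in> I \<Longrightarrow> N s \<bullet> u = c1"
proof -
  define f where "f s = c1 * s + c2" for s
  define w where "w s = 1 + (f s)\<^sup>2" for s
  define e where "e s = c3 / sqrt (w s)" for s
  let ?u = "\<lambda>s. c1 *\<^sub>R N s + e s *\<^sub>R (f s *\<^sub>R T s + B s)"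
  have w: "w s > 0" for s by (simp add: w_def add_pos_nonneg)
  have "(?u has_vector_derivative 0) (at s within I)" if s: "s \<in> I" for s
  proof -
    have \<kappa>: "\<kappa> s = c3 / (w s * sqrt (w s))"
      using curv[OF s] powr_three_halves[OF w, of s] by (simp add: w_def f_def)
    have \<tau>: "\<tau> s = f s * \<kappa> s" using ratio[OF s] by (simp add: f_def)
    have f': "(f has_real_derivative c1) (at s within I)"
      unfolding f_def by (auto intro!: derivative_eq_intros)
    have "(w has_real_derivative 2 * f s * c1) (at s within I)"
      unfolding w_def by (auto intro!: derivative_eq_intros f')
    then have e': "(e has_real_derivative - c1 * \<tau> s) (at s within I)"
      unfolding e_def using w[of s]
      by (auto intro!: derivative_eq_intros simp: \<tau> \<kappa> field_simps power2_eq_square)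
    have q': "((\<lambda>s. f s *\<^sub>R T s + B s) has_vector_derivative
        (f s *\<^sub>R \<kappa> s *\<^sub>R N s + c1 *\<^sub>R T s) + - \<tau> s *\<^sub>R N s) (at s within I)"
      by (intro has_vector_derivative_add has_vector_derivative_scaleR f' T'[OF s] B'[OF s])
    have "((\<lambda>s. c1 *\<^sub>R N s) has_vector_derivative
        c1 *\<^sub>R (- \<kappa> s *\<^sub>R T s + \<tau> s *\<^sub>R B s)) (at s within I)"
      by (rule bounded_linear.has_vector_derivative[OF bounded_linear_scaleR_right N'[OF s]])
    then have "(?u has_vector_derivative
        c1 *\<^sub>R (- \<kappa> s *\<^sub>R T s + \<tau> s *\<^sub>R B s) +
        (e s *\<^sub>R ((f s *\<^sub>R \<kappa> s *\<^sub>R N s + c1 *\<^sub>R T s) + - \<tau> s *\<^sub>R N s)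
          + (- c1 * \<tau> s) *\<^sub>R (f s *\<^sub>R T s + B s))) (at s within I)"
      by (intro has_vector_derivative_add has_vector_derivative_scaleR e' q')
    moreover have "c1 *\<^sub>R (- \<kappa> s *\<^sub>R T s + \<tau> s *\<^sub>R B s) +
        (e s *\<^sub>R ((f s *\<^sub>R \<kappa> s *\<^sub>R N s + c1 *\<^sub>R T s) + - \<tau> s *\<^sub>R N s)
          + (- c1 * \<tau> s) *\<^sub>R (f s *\<^sub>R T s + B s))
        = (c1 * (e s - \<kappa> s * w s)) *\<^sub>R T s"
      by (simp add: \<tau> w_def power2_eq_square algebra_simps)
    moreover have "e s = \<kappa> s * w s" using w[of s] by (simp add: e_def \<kappa>)
    ultimately show ?thesis by simp
  qed
  then obtain u where u: "\<And>s. s \<in> I \<Longrightarrow> ?u s = u"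
    by (rule constant_on_of_zero_derivative[OF interval(1)]) auto
  have Nu: "N s \<bullet> u = c1" if "s \<in> I" for s
    unfolding u[OF that, symmetric] using that
    by (simp add: inner_add_right frame_products inner_commute[of "N s" "T s"])
  moreover have "u \<noteq> 0"
    using interval_point Nu c1 by (metis inner_zero_right)
  ultimately show thesis using that by blast
qed

end

section \<open>The Frenet frame of a curve\<close>

text \<open>
  The torsion is by definition the one coordinate of \<open>b'\<close> which differentiating the orthonormality
  relations does not determine; all others of \<open>n'\<close> and \<open>b'\<close> follow from them. The third derivative
  of the curve enters through the differentiability of \<open>n = t' / |t'|\<close>.
\<close>

lemma frenet_frame_of_frenet_curve:
  assumes "frenet_curve I \<alpha>" "unit_speed I \<alpha>"
  shows "frenet_frame I \<alpha> (tangent I \<alpha>) (normal_vec I \<alpha>) (binormal I \<alpha>)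
    (curvature I \<alpha>) (torsion I \<alpha>)"
proof -
  let ?T = "tangent I \<alpha>" and ?N = "normal_vec I \<alpha>" and ?B = "binormal I \<alpha>"
    and ?\<kappa> = "curvature I \<alpha>" and ?\<tau> = "torsion I \<alpha>" and ?T1 = "curve_deriv I (tangent I \<alpha>)"
  have I: "is_interval I" "interior I \<noteq> {}" and nz: "\<And>s. s \<in> I \<Longrightarrow> ?T1 s \<noteq> 0"
    and diff: "\<And>j. j < 4 \<Longrightarrow> (curve_deriv I ^^ j) \<alpha> differentiable_on I"
    using assms(1) by (auto simp: frenet_curve_def C_k_curve_def)
  have works: "(g has_vector_derivative curve_deriv I g s) (at s within I)"
    if "g differentiable_on I" "s \<in> I" for g :: "real \<Rightarrow> real^3" and s
    using that by (simp add: curve_deriv_def differentiable_on_def vector_derivative_works)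
  have d0: "\<alpha> differentiable_on I" and d1: "?T differentiable_on I"
    and d2: "?T1 differentiable_on I"
    using diff[of 0] diff[of 1] diff[of 2] by (simp_all add: tangent_def numeral_2_eq_2)
  have TT: "?T s \<bullet> ?T s = 1" if "s \<in> I" for s
    using assms(2) that by (simp add: unit_speed_def tangent_def)
  have \<kappa>_pos: "0 < ?\<kappa> s" if "s \<in> I" for s
    using nz[OF that] by (simp add: curvature_def)
  have T1: "?T1 s = ?\<kappa> s *\<^sub>R ?N s" if "s \<in> I" for s
    using \<kappa>_pos[OF that] by (simp add: normal_vec_def)
  have NN: "?N s \<bullet> ?N s = 1" if "s \<in> I" for s
    using \<kappa>_pos[OF that]
    by (simp add: normal_vec_def curvature_def dot_square_norm power2_eq_square)
  have T': "(?T has_vector_derivative ?\<kappa> s *\<^sub>R ?N s) (at s within I)" if "s \<in> I" for s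
    using works[OF d1 that] T1[OF that] by simp
  have TN: "?T s \<bullet> ?N s = 0" if s: "s \<in> I" for s
  proof -
    have "?T s \<bullet> (?\<kappa> s *\<^sub>R ?N s) + (?\<kappa> s *\<^sub>R ?N s) \<bullet> ?T s = 0"
      by (rule vector_derivative_of_constant_on[OF I s TT has_vector_derivative_inner[OF T'[OF s] T'[OF s]]])
    then show ?thesis using \<kappa>_pos[OF s] by (simp add: inner_commute)
  qed
  have BB: "?B s \<bullet> ?B s = 1" "?T s \<bullet> ?B s = 0" "?N s \<bullet> ?B s = 0" if "s \<in> I" for s
    using TT[OF that] NN[OF that] TN[OF that]
    by (simp_all add: binormal_def inner_cross3_self dot_cross_self)
  have expand: "x = (x \<bullet> ?T s) *\<^sub>R ?T s + (x \<bullet> ?N s) *\<^sub>R ?N s + (x \<bullet> ?B s) *\<^sub>R ?B s"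
    if "s \<in> I" for s x
    unfolding binormal_def
    by (rule orthonormal_expansion_cross3) (use that in \<open>auto simp: TT NN TN\<close>)
  have norm_diff: "(\<lambda>x. norm (?T1 x)) differentiable (at s within I)" if "s \<in> I" for s
    using d2 nz[OF that] that
    by (auto simp: differentiable_on_def intro!: differentiable_compose[of norm, OF differentiable_norm_at])
  have dN: "?N differentiable_on I"
    unfolding differentiable_on_def normal_vec_def curvature_def
    using d2 norm_diff nz
    by (auto simp: differentiable_on_def intro!: differentiable_scaleR differentiable_inverse)
  have N1: "(?N has_vector_derivative curve_deriv I ?N s) (at s within I)" if "s \<in> I" for s
    by (rule works[OF dN that])
  have "(?B has_vector_derivative cross3 (?T s) (curve_deriv I ?N s) + cross3 (?\<kappa> s *\<^sub>R ?N s) (?N s))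
      (at s within I)" if "s \<in> I" for s
    unfolding binormal_def[abs_def]
    by (rule bounded_bilinear.has_vector_derivative[OF bilinear_conv_bounded_bilinear[THEN iffD1,
          OF bilinear_cross] T'[OF that] N1[OF that]])
  then have dB: "?B differentiable_on I"
    by (auto simp: differentiable_on_def intro: differentiableI_vector)
  have B1: "(?B has_vector_derivative curve_deriv I ?B s) (at s within I)" if "s \<in> I" for s
    by (rule works[OF dB that])
  have product: "X s \<bullet> Y' + X' \<bullet> Y s = 0"
    if "s \<in> I" "\<And>x. x \<in> I \<Longrightarrow> X x \<bullet> Y x = c" "(X has_vector_derivative X') (at s within I)"
      "(Y has_vector_derivative Y') (at s within I)" for X Y :: "real \<Rightarrow> real^3" and X' Y' s c
    by (rule vector_derivative_of_constant_on[OF I that(1,2) has_vector_derivative_inner[OF that(3,4)]])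
  have \<tau>: "curve_deriv I ?B s \<bullet> ?N s = - ?\<tau> s" for s by (simp add: torsion_def)
  have "(?B has_vector_derivative - ?\<tau> s *\<^sub>R ?N s) (at s within I)" if s: "s \<in> I" for s
  proof -
    have "curve_deriv I ?B s \<bullet> ?T s = 0"
      using product[OF s BB(2) T'[OF s] B1[OF s]] BB[OF s] by (simp add: inner_commute)
    moreover have "curve_deriv I ?B s \<bullet> ?B s = 0"
      using product[OF s BB(1) B1[OF s] B1[OF s]] by (simp add: inner_commute)
    ultimately have "curve_deriv I ?B s = - ?\<tau> s *\<^sub>R ?N s"
      using expand[OF s, of "curve_deriv I ?B s"] \<tau>[of s] by simp
    then show ?thesis using B1[OF s] by simp
  qed
  moreover have "(?N has_vector_derivative - ?\<kappa> s *\<^sub>R ?T s + ?\<tau> s *\<^sub>R ?B s) (at s within I)"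
    if s: "s \<in> I" for s
  proof -
    have "curve_deriv I ?N s \<bullet> ?T s = - ?\<kappa> s"
      using product[OF s TN T'[OF s] N1[OF s]] NN[OF s] by (simp add: inner_commute)
    moreover have "curve_deriv I ?N s \<bullet> ?N s = 0"
      using product[OF s NN N1[OF s] N1[OF s]] by (simp add: inner_commute)
    moreover have "curve_deriv I ?N s \<bullet> ?B s = ?\<tau> s"
      using product[OF s BB(3) N1[OF s] B1[OF s]] \<tau>[of s] by (simp add: inner_commute)
    ultimately have "curve_deriv I ?N s = - ?\<kappa> s *\<^sub>R ?T s + ?\<tau> s *\<^sub>R ?B s"
      using expand[OF s, of "curve_deriv I ?N s"] by simp
    then show ?thesis using N1[OF s] by simp
  qed
  moreover have "(\<alpha> has_vector_derivative ?T s) (at s within I)" if "s \<in> I" for s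
    using works[OF d0 that] by (simp add: tangent_def)
  ultimately show ?thesis
    by unfold_locales (use I TT NN TN \<kappa>_pos T' in \<open>auto simp: binormal_def\<close>)
qed

text \<open>
  Choosing another origin changes neither the frame nor curvature and torsion. The equality holds for all
  parameters, also where \<open>\<alpha>\<close> has no derivative, since translation does not alter
  the set of vector derivatives from which \<open>vector_derivative\<close> selects.
\<close>

lemma curve_deriv_translate: "curve_deriv I (\<lambda>s. \<alpha> s - p) = curve_deriv I \<alpha>"
  using has_vector_derivative_add_const[of \<alpha> "- p"]
  by (simp add: fun_eq_iff curve_deriv_def vector_derivative_def)

lemma tangent_translate: "tangent I (\<lambda>s. \<alpha> s - p) = tangent I \<alpha>"
  by (simp add: tangent_def curve_deriv_translate)

lemma normal_vec_translate: "normal_vec I (\<lambda>s. \<alpha> s - p) = normal_vec I \<alpha>"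
  by (simp add: fun_eq_iff normal_vec_def curvature_def tangent_translate)

lemma binormal_translate: "binormal I (\<lambda>s. \<alpha> s - p) = binormal I \<alpha>"
  by (simp add: fun_eq_iff binormal_def tangent_translate normal_vec_translate)

lemma unit_speed_translate: "unit_speed I (\<lambda>s. \<alpha> s - p) \<longleftrightarrow> unit_speed I \<alpha>"
  by (simp add: unit_speed_def curve_deriv_translate)

text \<open>
  The cosine recovers the inner product from the angle because the Cauchy-Schwarz inequality keeps the
  argument of \<open>arccos\<close> in \<open>[-1, 1]\<close>.
\<close>

lemma slant_helix_iff_inner_constant:
  assumes unit: "\<And>s. s \<in> I \<Longrightarrow> norm (normal_vec I \<alpha> s) = 1"
  shows "slant_helix I \<alpha> \<longleftrightarrow> (\<exists>u c. u \<noteq> 0 \<and> (\<forall>s\<in>I. normal_vec I \<alpha> s \<bullet> u = c))"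
proof
  assume "slant_helix I \<alpha>"
  then obtain u \<theta> where u: "u \<noteq> 0" and "\<forall>s\<in>I. vec_angle (normal_vec I \<alpha> s) u = \<theta>"
    unfolding slant_helix_def by blast
  moreover have "normal_vec I \<alpha> s \<bullet> u = norm u * cos (vec_angle (normal_vec I \<alpha> s) u)"
    if "s \<in> I" for s
  proof -
    have "\<bar>normal_vec I \<alpha> s \<bullet> u\<bar> \<le> norm u"
      using Cauchy_Schwarz_ineq2[of "normal_vec I \<alpha> s" u] unit[OF that] by simp
    then have "\<bar>normal_vec I \<alpha> s \<bullet> u / norm u\<bar> \<le> 1" using u by simp
    then have "cos (vec_angle (normal_vec I \<alpha> s) u) = normal_vec I \<alpha> s \<bullet> u / norm u"
      using unit[OF that] by (simp add: vec_angle_def cos_arccos_abs)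
    then show ?thesis using u by simp
  qed
  ultimately show "\<exists>u c. u \<noteq> 0 \<and> (\<forall>s\<in>I. normal_vec I \<alpha> s \<bullet> u = c)" by auto
next
  assume "\<exists>u c. u \<noteq> 0 \<and> (\<forall>s\<in>I. normal_vec I \<alpha> s \<bullet> u = c)"
  then show "slant_helix I \<alpha>"
    unfolding slant_helix_def vec_angle_def by (metis unit)
qed

theorem theorem3:
  fixes I :: "real set" and \<alpha> :: "real \<Rightarrow> real^3"
  assumes "frenet_curve I \<alpha>" and "unit_speed I \<alpha>"
  shows "(\<exists>p. rectifying_slant_helix I (\<lambda>s. \<alpha> s - p)) \<longleftrightarrow>
    (\<exists>c1 c2 c3 :: real. c1 \<noteq> 0 \<and> c3 > 0 \<and>
      (\<forall>s\<in>I. curvature I \<alpha> s = c3 / (1 + (c1 * s + c2)\<^sup>2) powr (3/2) \<and>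
              torsion I \<alpha> s = c3 * (c1 * s + c2) / (1 + (c1 * s + c2)\<^sup>2) powr (3/2)))"
proof -
  interpret frenet_frame I \<alpha> "tangent I \<alpha>" "normal_vec I \<alpha>" "binormal I \<alpha>" "curvature I \<alpha>"
    "torsion I \<alpha>"
    using assms by (rule frenet_frame_of_frenet_curve)
  have unit: "norm (normal_vec I \<alpha> s) = 1" if "s \<in> I" for s
    using orthonormal(2)[OF that] by (simp add: norm_eq_1)
  have slant: "slant_helix I (\<lambda>s. \<alpha> s - p) \<longleftrightarrow>
      (\<exists>u c. u \<noteq> 0 \<and> (\<forall>s\<in>I. normal_vec I \<alpha> s \<bullet> u = c))" for p
    using slant_helix_iff_inner_constant[of I "\<lambda>s. \<alpha> s - p"] unit
    by (simp add: normal_vec_translate)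
  have rect: "rectifying_curve I (\<lambda>s. \<alpha> s - p) \<longleftrightarrow>
      (\<exists>l m. \<forall>s\<in>I. \<alpha> s - p = l s *\<^sub>R tangent I \<alpha> s + m s *\<^sub>R binormal I \<alpha> s)" for p
    using assms(2)
    by (simp add: rectifying_curve_def unit_speed_translate tangent_translate binormal_translate)
  show ?thesis
  proof
    assume "\<exists>p. rectifying_slant_helix I (\<lambda>s. \<alpha> s - p)"
    then obtain p u c l m where u: "u \<noteq> 0" "\<And>s. s \<in> I \<Longrightarrow> normal_vec I \<alpha> s \<bullet> u = c"
      and lm: "\<And>s. s \<in> I \<Longrightarrow> \<alpha> s - p = l s *\<^sub>R tangent I \<alpha> s + m s *\<^sub>R binormal I \<alpha> s"
      unfolding rectifying_slant_helix_def slant rect by blast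
    have normal0: "\<And>s. s \<in> I \<Longrightarrow> (\<alpha> s - p) \<bullet> normal_vec I \<alpha> s = 0"
      using frame_products by (simp add: lm inner_simps inner_commute)
    obtain c1 c2 :: real where c1: "c1 \<noteq> 0"
      and ratio: "\<And>s. s \<in> I \<Longrightarrow> torsion I \<alpha> s = (c1 * s + c2) * curvature I \<alpha> s"
      using rectifying_imp_affine_ratio[OF normal0] by blast
    obtain c3 where "c3 > 0"
      "\<And>s. s \<in> I \<Longrightarrow> curvature I \<alpha> s = c3 / (1 + (c1 * s + c2)\<^sup>2) powr (3/2)"
      using slant_imp_curvature[OF c1 ratio u] by blast
    with c1 ratio show "\<exists>c1 c2 c3 :: real. c1 \<noteq> 0 \<and> c3 > 0 \<and>
      (\<forall>s\<in>I. curvature I \<alpha> s = c3 / (1 + (c1 * s + c2)\<^sup>2) powr (3/2) \<and>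
              torsion I \<alpha> s = c3 * (c1 * s + c2) / (1 + (c1 * s + c2)\<^sup>2) powr (3/2))"
      by (intro exI[of _ c1] exI[of _ c2] exI[of _ c3]) (auto simp: mult.commute)
  next
    assume "\<exists>c1 c2 c3 :: real. c1 \<noteq> 0 \<and> c3 > 0 \<and>
      (\<forall>s\<in>I. curvature I \<alpha> s = c3 / (1 + (c1 * s + c2)\<^sup>2) powr (3/2) \<and>
              torsion I \<alpha> s = c3 * (c1 * s + c2) / (1 + (c1 * s + c2)\<^sup>2) powr (3/2))"
    then obtain c1 c2 c3 where c1: "c1 \<noteq> 0"
      and curv: "\<And>s. s \<in> I \<Longrightarrow> curvature I \<alpha> s = c3 / (1 + (c1 * s + c2)\<^sup>2) powr (3/2)"
      and "\<And>s. s \<in> I \<Longrightarrow> torsion I \<alpha> s = c3 * (c1 * s + c2) / (1 + (c1 * s + c2)\<^sup>2) powr (3/2)"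
      by blast
    then have ratio: "\<And>s. s \<in> I \<Longrightarrow> torsion I \<alpha> s = (c1 * s + c2) * curvature I \<alpha> s"
      by (simp add: mult.commute)
    obtain u where "u \<noteq> 0" "\<And>s. s \<in> I \<Longrightarrow> normal_vec I \<alpha> s \<bullet> u = c1"
      using curvature_imp_slant[OF c1 ratio curv] by blast
    then have helix: "slant_helix I (\<lambda>s. \<alpha> s - q)" for q
      unfolding slant by blast
    obtain p where p: "\<And>s. s \<in> I \<Longrightarrow>
        \<alpha> s - p = ((c1 * s + c2) / c1) *\<^sub>R tangent I \<alpha> s + (1 / c1) *\<^sub>R binormal I \<alpha> s"
      using affine_ratio_imp_rectifying[OF c1 ratio] by blast
    have "rectifying_curve I (\<lambda>s. \<alpha> s - p)"
      unfolding rect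
      by (intro exI[of _ "\<lambda>s. (c1 * s + c2) / c1"] exI[of _ "\<lambda>_. 1 / c1"] ballI p)
    with helix[of p] show "\<exists>p. rectifying_slant_helix I (\<lambda>s. \<alpha> s - p)"
      by (intro exI[of _ p]) (simp add: rectifying_slant_helix_def)
  qed
qed

end
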